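(* Let $(H;\langle\cdot,\cdot\rangle)$ be an inner product space over $\mathbb{K}$, let $x,a\in H$ and $r>0$. If $x\in \bar B(a,r):=\{z\in H : \|z-a\|\le r\}$, then $$0\le \|x\|\,\|a\|-|\langle x,a\rangle|\le \|x\|\,\|a\|-|\operatorname{Re}\langle x,a\rangle|\le \|x\|\,\|a\|-\operatorname{Re}\langle x,a\rangle\le \tfrac12 r^2 .$$ The constant $\frac12$ is best possible, in the sense that it cannot be replaced by a smaller constant: there is no $c<\frac12$ such that $\|x\|\,\|a\|-\operatorname{Re}\langle x,a\rangle\le c\,r^2$ holds for all inner product spaces $H$ over $\mathbb{K}$, all $x,a\in H$ and all $r>0$ with $\|x-a\|\le r$.
   Context: $\mathbb{K}$ denotes $\mathbb{R}$ or $\mathbb{C}$. Inner products are linear in the first argument and conjugate-linear in the second, and $\|x\|=\langle x,x\rangle^{1/2}$. *)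

theory Defs
  imports "HOL-Analysis.Inner_Product"
begin

text \<open>The scalar field \<open>\<bbbK>\<close>: the class axioms say that \<open>to_complex\<close> is an isometric isomorphism of
  real algebras from \<open>'a\<close> onto the real numbers or onto the complex numbers, so that \<open>real\<close> and
  \<open>complex\<close> are, up to isomorphism, the only instances.\<close>

class real_or_complex = real_normed_field +
  fixes to_complex :: "'a \<Rightarrow> complex"
  assumes to_complex_add: "to_complex (x + y) = to_complex x + to_complex y"
    and to_complex_mult: "to_complex (x * y) = to_complex x * to_complex y"
    and to_complex_scaleR: "to_complex (r *\<^sub>R x) = r *\<^sub>R to_complex x"
    and norm_to_complex: "norm (to_complex x) = norm x"
    and range_to_complex: "range to_complex = \<real> \<or> range to_complex = UNIV"

instantiation real :: real_or_complex
begin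
definition to_complex_real :: "real \<Rightarrow> complex" where "to_complex_real = complex_of_real"
instance
  by standard (auto simp: to_complex_real_def scaleR_conv_of_real Reals_def)
end

instantiation complex :: real_or_complex
begin
definition to_complex_complex :: "complex \<Rightarrow> complex" where "to_complex_complex z = z"
instance
  by standard (auto simp: to_complex_complex_def)
end

definition re :: "'k::real_or_complex \<Rightarrow> real" where
  "re z = Re (to_complex z)"

text \<open>Conjugate symmetry makes \<open>ip x x\<close> real, so \<open>re (ip x x)\<close> is \<open>ip x x\<close> itself; together with
  the linearity in the first argument it gives conjugate-linearity in the second.\<close>

locale inner_product_space = vector_space scale
  for scale :: "'k::real_or_complex \<Rightarrow> 'v::ab_group_add \<Rightarrow> 'v" +
  fixes ip :: "'v \<Rightarrow> 'v \<Rightarrow> 'k"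
  assumes ip_add_left: "ip (x + y) z = ip x z + ip y z"
    and ip_scale_left: "ip (scale c x) y = c * ip x y"
    and ip_conj_sym: "to_complex (ip y x) = cnj (to_complex (ip x y))"
    and ip_nonneg: "0 \<le> re (ip x x)"
    and ip_definite: "ip x x = 0 \<Longrightarrow> x = 0"

definition ip_norm :: "('v \<Rightarrow> 'v \<Rightarrow> 'k::real_or_complex) \<Rightarrow> 'v \<Rightarrow> real" where
  "ip_norm ip x = sqrt (re (ip x x))"

definition ip_cball :: "('v::ab_group_add \<Rightarrow> 'v \<Rightarrow> 'k::real_or_complex) \<Rightarrow> 'v \<Rightarrow> real \<Rightarrow> 'v set" where
  "ip_cball ip a r = {z. ip_norm ip (z - a) \<le> r}"

lemma inner_product_space_real_inner:
  "inner_product_space (scaleR :: real \<Rightarrow> 'a \<Rightarrow> 'a::real_inner) inner"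
  by unfold_locales
    (auto simp: re_def to_complex_real_def inner_add_left inner_commute algebra_simps)

lemma ip_norm_real_inner: "ip_norm inner (x :: 'a::real_inner) = norm x"
  by (simp add: ip_norm_def re_def to_complex_real_def norm_eq_sqrt_inner)

lemma inner_product_space_complex:
  "inner_product_space ((*) :: complex \<Rightarrow> complex \<Rightarrow> complex) (\<lambda>x y. x * cnj y)"
  by unfold_locales (auto simp: re_def to_complex_complex_def algebra_simps)

end

theory Submission
  imports Defs
begin

text \<open>Cauchy-Schwarz gives the first inequality. The last one follows from
  \<open>\<parallel>x - a\<parallel>\<^sup>2 = (\<parallel>x\<parallel> - \<parallel>a\<parallel>)\<^sup>2 + 2 (\<parallel>x\<parallel> \<parallel>a\<parallel> - Re \<langle>x, a\<rangle>)\<close>. Equality holds for antipodal points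
  \<open>x = - a\<close> and \<open>r = 2 \<parallel>a\<parallel>\<close>, already in the one-dimensional space \<open>\<bbbK>\<close>, so \<open>1/2\<close> is best possible.\<close>

lemma to_complex_0 [simp]: "to_complex 0 = 0"
  using to_complex_scaleR[of 0 0] by simp

lemma to_complex_minus: "to_complex (- x) = - to_complex x"
  using to_complex_scaleR[of "-1" x] by simp

lemma to_complex_diff: "to_complex (x - y) = to_complex x - to_complex y"
  using to_complex_add[of x "- y"] by (simp add: to_complex_minus)

text \<open>An additive isometry has trivial kernel.\<close>

lemma inj_to_complex: "inj to_complex"
proof (rule injI)
  fix x y :: 'a
  assume "to_complex x = to_complex y"
  then have "norm (to_complex (x - y)) = 0"
    by (simp add: to_complex_diff)
  then show "x = y"
    by (simp add: norm_to_complex)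
qed

lemma to_complex_1 [simp]: "to_complex 1 = 1"
proof -
  \<comment> \<open>The image of 1 is idempotent in a field, and nonzero by isometry.\<close>
  have "to_complex (1 :: 'a) * to_complex (1 :: 'a) = to_complex (1 :: 'a)"
    using to_complex_mult[of "1 :: 'a" 1] by simp
  moreover have "to_complex (1 :: 'a) \<noteq> 0"
    using norm_to_complex[of "1 :: 'a"] by auto
  ultimately show ?thesis
    by simp
qed

lemma abs_re_le_norm: "\<bar>re z\<bar> \<le> norm z"
  unfolding re_def by (metis abs_Re_le_cmod norm_to_complex)

definition conjugate :: "'k::real_or_complex \<Rightarrow> 'k" where
  "conjugate z = inv to_complex (cnj (to_complex z))"

text \<open>Both admissible ranges, the real line and the complex plane, are closed under
  \<open>cnj\<close>, so \<open>inv\<close> is applied inside the range.\<close>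

lemma to_complex_conjugate: "to_complex (conjugate z) = cnj (to_complex z)"
proof -
  have "cnj (to_complex z) \<in> range (to_complex :: 'a \<Rightarrow> complex)"
    using range_to_complex[where 'a = 'a] by (metis Reals_cnj_iff UNIV_I rangeI)
  then show ?thesis
    unfolding conjugate_def by (rule f_inv_into_f)
qed

lemma to_complex_mult_conjugate: "to_complex (z * conjugate z) = complex_of_real ((norm z)\<^sup>2)"
  by (simp add: to_complex_mult to_complex_conjugate complex_norm_square[symmetric] norm_to_complex del: of_real_power)

text \<open>Provides an inner product space over every admissible \<open>'k\<close>, in which
  sharpness of the constant is tested.\<close>

lemma inner_product_space_scalars:
  "inner_product_space ((*) :: 'k::real_or_complex \<Rightarrow> 'k \<Rightarrow> 'k) (\<lambda>x y. x * conjugate y)"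
proof unfold_locales
  fix x y :: 'k
  show "to_complex (y * conjugate x) = cnj (to_complex (x * conjugate y))"
    by (simp add: to_complex_mult to_complex_conjugate mult.commute)
  show "0 \<le> re (x * conjugate x)"
    by (simp add: re_def to_complex_mult_conjugate)
  show "x = 0" if "x * conjugate x = 0"
    using that to_complex_mult_conjugate[of x] by (simp del: mult_eq_0_iff)
qed (auto simp: algebra_simps)

lemma ip_norm_scalars: "ip_norm (\<lambda>x y. x * conjugate y) x = norm x"
  by (simp add: ip_norm_def re_def to_complex_mult_conjugate)

context inner_product_space
begin

lemma ip_diff_left: "ip (x - y) z = ip x z - ip y z"
  using ip_add_left[of "x - y" y z] by simp

lemma ip_zero_left [simp]: "ip 0 z = 0"
  using ip_diff_left[of z z z] by simp

lemma to_complex_ip_diff_right: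
  "to_complex (ip z (x - y)) = to_complex (ip z x) - to_complex (ip z y)"
  by (metis ip_conj_sym ip_diff_left to_complex_diff complex_cnj_diff)

lemma to_complex_ip_scale_right:
  "to_complex (ip z (scale c x)) = cnj (to_complex c) * to_complex (ip z x)"
  by (metis ip_conj_sym ip_scale_left to_complex_mult complex_cnj_mult)

lemma ip_norm_nonneg: "0 \<le> ip_norm ip x"
  by (simp add: ip_norm_def ip_nonneg)

text \<open>Conjugate symmetry makes the value its own conjugate, hence real; by
  \<open>ip_nonneg\<close>, squaring undoes the root in \<open>ip_norm\<close>.\<close>

lemma to_complex_ip_self: "to_complex (ip x x) = complex_of_real ((ip_norm ip x)\<^sup>2)"
proof -
  have "to_complex (ip x x) \<in> \<real>"
    using ip_conj_sym[of x x] by (metis Reals_cnj_iff)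
  then show ?thesis
    by (simp add: ip_norm_def ip_nonneg re_def[symmetric] complex_eq_iff complex_is_Real_iff)
qed

lemma ip_norm_eq_0_iff: "ip_norm ip x = 0 \<longleftrightarrow> x = 0"
proof
  assume "ip_norm ip x = 0"
  then have "to_complex (ip x x) = to_complex 0"
    by (simp add: to_complex_ip_self)
  then show "x = 0"
    using inj_to_complex ip_definite by (metis injD)
qed (simp add: ip_norm_def re_def)

text \<open>For nonzero \<open>a\<close>, expand \<open>ip z z\<close> for a multiple
  \<open>z\<close> of the component of \<open>x\<close> orthogonal to \<open>a\<close>, and cancel a
  positive factor from its nonnegativity.\<close>

lemma cauchy_schwarz: "norm (ip x a) \<le> ip_norm ip x * ip_norm ip a"
proof (cases "a = 0")
  case True
  have "to_complex (ip x a) = 0"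
    using ip_conj_sym[of a x] True by simp
  then have "norm (ip x a) = 0"
    by (metis norm_to_complex norm_zero)
  then show ?thesis
    by (simp add: ip_norm_nonneg)
next
  case False
  define A where "A = (ip_norm ip a)\<^sup>2"
  have "A > 0"
    using False by (simp add: A_def ip_norm_eq_0_iff)
  define z where "z = scale (ip a a) x - scale (ip x a) a"
    \<comment> \<open>the component of \<open>x\<close> orthogonal to \<open>a\<close>, scaled by \<open>ip a a\<close> to avoid division\<close>
  have "ip z a = 0"
    by (simp add: z_def ip_diff_left ip_scale_left)
  \<comment> \<open>Only the second argument is expanded: its \<open>a\<close> term vanishes by
    orthogonality, and the coefficient \<open>ip a a\<close> is real, so conjugation leaves
    \<open>A\<close>.\<close>
  then have "to_complex (ip z z) = A * to_complex (ip z x)"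
    by (subst (2) z_def)
      (simp add: to_complex_ip_diff_right to_complex_ip_scale_right to_complex_ip_self A_def)
  also have "to_complex (ip z x) = A * to_complex (ip x x) - to_complex (ip x a) * to_complex (ip a x)"
    by (simp add: z_def ip_diff_left ip_scale_left to_complex_diff to_complex_mult
        to_complex_ip_self A_def)
  also have "\<dots> = complex_of_real (A * (ip_norm ip x)\<^sup>2 - (norm (ip x a))\<^sup>2)"
    by (simp add: ip_conj_sym[of a x] complex_norm_square[symmetric] norm_to_complex to_complex_ip_self)
  finally have "re (ip z z) = A * (A * (ip_norm ip x)\<^sup>2 - (norm (ip x a))\<^sup>2)"
    by (simp add: re_def)
  then have "0 \<le> A * (ip_norm ip x)\<^sup>2 - (norm (ip x a))\<^sup>2"
    using ip_nonneg[of z] \<open>A > 0\<close> by (simp add: zero_le_mult_iff)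
  then have "(norm (ip x a))\<^sup>2 \<le> (ip_norm ip x * ip_norm ip a)\<^sup>2"
    by (simp add: A_def power_mult_distrib mult.commute)
  then show ?thesis
    by (rule power2_le_imp_le) (simp add: ip_norm_nonneg)
qed

text \<open>The two cross terms are conjugate to each other, so they add up to twice the real
  part.\<close>

lemma ip_norm_diff_sq:
  "(ip_norm ip (x - a))\<^sup>2 = (ip_norm ip x)\<^sup>2 + (ip_norm ip a)\<^sup>2 - 2 * re (ip x a)"
proof -
  have "(ip_norm ip y)\<^sup>2 = Re (to_complex (ip y y))" for y
    by (simp add: to_complex_ip_self)
  then show ?thesis
    by (simp add: ip_diff_left to_complex_diff to_complex_ip_diff_right ip_conj_sym[of a x] re_def)
qed

lemma ip_norm_mult_diff_re_le:
  assumes "ip_norm ip (x - a) \<le> r"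
  shows "ip_norm ip x * ip_norm ip a - re (ip x a) \<le> 1 / 2 * r\<^sup>2"
proof -
  have "(ip_norm ip (x - a))\<^sup>2 \<le> r\<^sup>2"
    using assms ip_norm_nonneg by (rule power_mono)
  moreover have "0 \<le> (ip_norm ip x - ip_norm ip a)\<^sup>2"
    by simp
  ultimately show ?thesis
    unfolding ip_norm_diff_sq power2_diff by linarith
qed

end

lemma half_le_constant:
  assumes "\<And>x a :: 'k::real_or_complex. \<And>r. \<lbrakk>r > 0; norm (x - a) \<le> r\<rbrakk> \<Longrightarrow>
    norm x * norm a - re (x * conjugate a) \<le> c * r\<^sup>2"
  shows "1 / 2 \<le> c"
proof -
  have "norm (1 - (- 1) :: 'k) = 2"
    by simp
  moreover have "re (1 * conjugate (- 1 :: 'k)) = - 1"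
    by (simp add: re_def to_complex_conjugate to_complex_minus)
  \<comment> \<open>With \<open>r = 2\<close>, \<open>x = 1\<close> and \<open>a = - 1\<close> the
    assumption reads \<open>2 \<le> 4 * c\<close>.\<close>
  ultimately show ?thesis
    using assms[of 2 1 "- 1"] by simp
qed

(* HOL cannot quantify over types inside a formula.  In the second conjunct the inner product
   spaces over 'k range over all scalar multiplications and inner products on the additive group
   of the type 'k; refuting c for these refutes it for the class of all spaces. *)
theorem theorem1:
  fixes scale :: "'k::real_or_complex \<Rightarrow> 'v::ab_group_add \<Rightarrow> 'v"
    and ip :: "'v \<Rightarrow> 'v \<Rightarrow> 'k"
  shows "(inner_product_space scale ip \<longrightarrow>
      (\<forall>x a. \<forall>r>0. x \<in> ip_cball ip a r \<longrightarrow>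
          0 \<le> ip_norm ip x * ip_norm ip a - norm (ip x a)
        \<and> ip_norm ip x * ip_norm ip a - norm (ip x a)
            \<le> ip_norm ip x * ip_norm ip a - \<bar>re (ip x a)\<bar>
        \<and> ip_norm ip x * ip_norm ip a - \<bar>re (ip x a)\<bar>
            \<le> ip_norm ip x * ip_norm ip a - re (ip x a)
        \<and> ip_norm ip x * ip_norm ip a - re (ip x a) \<le> 1 / 2 * r\<^sup>2))
    \<and> \<not> (\<exists>c<1 / 2. \<forall>(scale' :: 'k \<Rightarrow> 'k \<Rightarrow> 'k) (ip' :: 'k \<Rightarrow> 'k \<Rightarrow> 'k).
          inner_product_space scale' ip' \<longrightarrow>
          (\<forall>x a. \<forall>r>0. ip_norm ip' (x - a) \<le> r \<longrightarrow>
             ip_norm ip' x * ip_norm ip' a - re (ip' x a) \<le> c * r\<^sup>2))"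
proof (intro conjI impI allI notI; (elim exE conjE)?)
  fix x a and r :: real
  assume "inner_product_space scale ip" and x: "x \<in> ip_cball ip a r"
  then interpret inner_product_space scale ip by simp
  show "0 \<le> ip_norm ip x * ip_norm ip a - norm (ip x a)"
    using cauchy_schwarz by simp
  show "ip_norm ip x * ip_norm ip a - norm (ip x a)
      \<le> ip_norm ip x * ip_norm ip a - \<bar>re (ip x a)\<bar>"
    using abs_re_le_norm by simp
  show "ip_norm ip x * ip_norm ip a - \<bar>re (ip x a)\<bar> \<le> ip_norm ip x * ip_norm ip a - re (ip x a)"
    by simp
  show "ip_norm ip x * ip_norm ip a - re (ip x a) \<le> 1 / 2 * r\<^sup>2"
    using x ip_norm_mult_diff_re_le by (simp add: ip_cball_def)
next
  fix c :: real
  assume "c < 1 / 2"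
    and *: "\<forall>(scale' :: 'k \<Rightarrow> 'k \<Rightarrow> 'k) (ip' :: 'k \<Rightarrow> 'k \<Rightarrow> 'k).
          inner_product_space scale' ip' \<longrightarrow>
          (\<forall>x a. \<forall>r>0. ip_norm ip' (x - a) \<le> r \<longrightarrow>
             ip_norm ip' x * ip_norm ip' a - re (ip' x a) \<le> c * r\<^sup>2)"
  \<comment> \<open>The scalar field as a space over itself suffices; its \<open>ip_norm\<close> is
    the norm of \<open>'k\<close>.\<close>
  have "1 / 2 \<le> c"
    using *[rule_format, OF inner_product_space_scalars]
    by (intro half_le_constant[where 'k = 'k]) (simp add: ip_norm_scalars)
  with \<open>c < 1 / 2\<close> show False by simp
qed

end
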